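(* Let $(\mathfrak g,\omega)$ be a four dimensional real symplectic Lie algebra such that $\mathfrak g$ is either completely solvable or isomorphic to $\mathfrak{aff}(\mathbb C)$ (viewed as a real Lie algebra). Then $(\mathfrak g,\omega)$ is a solution of the cotangent extension problem.
   Context: A symplectic form on a $2n$-dimensional real Lie algebra is a closed (Chevalley–Eilenberg, trivial coefficients) 2-form $\omega$ with $\omega^n\neq0$. A solvable real Lie algebra $\mathfrak g$ is completely solvable if $\operatorname{ad}_x$ has only real eigenvalues for all $x\in\mathfrak g$. The Lie algebra $\mathfrak{aff}(\mathbb C)$, regarded as a real Lie algebra, has basis $e_1,\dots,e_4$ with nonzero brackets $[e_1,e_3]=e_3$, $[e_1,e_4]=e_4$, $[e_2,e_3]=e_4$, $[e_2,e_4]=-e_3$. Cotangent extension problem: for a Lie algebra $\mathfrak h$ with dual space $\mathfrak h^*$, let $\omega_0((\varphi,x),(\varphi',x'))=\varphi(x')-\varphi'(x)$ on $\mathfrak h^*\oplus\mathfrak h$. One looks for Lie algebra structures on the vector space $\mathfrak h^*\oplus\mathfrak h$ such that (c1) $0\to\mathfrak h^*\to\mathfrak h^*\oplus\mathfrak h\to\mathfrak h\to0$ (canonical inclusion and projection) is an exact sequence of Lie algebras, $\mathfrak h^*$ being abelian; and (c2) $\omega_0$ is closed. A symplectic Lie algebra $(\mathfrak g,\omega)$ is a solution of the cotangent extension problem if there is a Lie algebra isomorphism, carrying $\omega$ to $\omega_0$, from $\mathfrak g$ onto some $\mathfrak h^*\oplus\mathfrak h$ with a Lie algebra structure satisfying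 (c1) and (c2). *)

theory Defs
  imports "HOL-Analysis.Analysis"
begin

section \<open>Real Lie algebras\<close>

definition lie_algebra :: "('g::real_vector \<Rightarrow> 'g \<Rightarrow> 'g) \<Rightarrow> bool" where
  "lie_algebra br \<longleftrightarrow> bilinear br \<and> (\<forall>x. br x x = 0) \<and>
     (\<forall>x y z. br x (br y z) + br y (br z x) + br z (br x y) = 0)"

definition lie_hom ::
  "('a::real_vector \<Rightarrow> 'a \<Rightarrow> 'a) \<Rightarrow> ('b::real_vector \<Rightarrow> 'b \<Rightarrow> 'b) \<Rightarrow> ('a \<Rightarrow> 'b) \<Rightarrow> bool" where
  "lie_hom br br' f \<longleftrightarrow> linear f \<and> (\<forall>x y. f (br x y) = br' (f x) (f y))"

definition lie_iso ::
  "('a::real_vector \<Rightarrow> 'a \<Rightarrow> 'a) \<Rightarrow> ('b::real_vector \<Rightarrow> 'b \<Rightarrow> 'b) \<Rightarrow> ('a \<Rightarrow> 'b) \<Rightarrow> bool" where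
  "lie_iso br br' f \<longleftrightarrow> lie_hom br br' f \<and> bij f"

definition lie_isomorphic ::
  "('a::real_vector \<Rightarrow> 'a \<Rightarrow> 'a) \<Rightarrow> ('b::real_vector \<Rightarrow> 'b \<Rightarrow> 'b) \<Rightarrow> bool" where
  "lie_isomorphic br br' \<longleftrightarrow> (\<exists>f. lie_iso br br' f)"

primrec derived_series :: "('g::real_vector \<Rightarrow> 'g \<Rightarrow> 'g) \<Rightarrow> nat \<Rightarrow> 'g set" where
  "derived_series br 0 = UNIV"
| "derived_series br (Suc k) =
     span {br x y |x y. x \<in> derived_series br k \<and> y \<in> derived_series br k}"

definition solvable_lie :: "('g::real_vector \<Rightarrow> 'g \<Rightarrow> 'g) \<Rightarrow> bool" where
  "solvable_lie br \<longleftrightarrow> (\<exists>k. derived_series br k = {0})"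

text \<open>Eigenvalues of a real endomorphism are those of its complexification. The pair
  \<open>(u, v)\<close> stands for \<open>u + \<i> v\<close> in the complexified space.\<close>

definition complexified_scale :: "complex \<Rightarrow> 'g::real_vector \<times> 'g \<Rightarrow> 'g \<times> 'g" where
  "complexified_scale c w =
     (Re c *\<^sub>R fst w - Im c *\<^sub>R snd w, Re c *\<^sub>R snd w + Im c *\<^sub>R fst w)"

definition complexified_map :: "('g::real_vector \<Rightarrow> 'g) \<Rightarrow> 'g \<times> 'g \<Rightarrow> 'g \<times> 'g" where
  "complexified_map T w = (T (fst w), T (snd w))"

definition complex_eigenvalue :: "('g::real_vector \<Rightarrow> 'g) \<Rightarrow> complex \<Rightarrow> bool" where
  "complex_eigenvalue T c \<longleftrightarrow> (\<exists>w. w \<noteq> 0 \<and> complexified_map T w = complexified_scale c w)"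

text \<open>Here \<open>br x\<close> is the adjoint operator of \<open>x\<close>.\<close>

definition completely_solvable :: "('g::real_vector \<Rightarrow> 'g \<Rightarrow> 'g) \<Rightarrow> bool" where
  "completely_solvable br \<longleftrightarrow>
     solvable_lie br \<and> (\<forall>x c. complex_eigenvalue (br x) c \<longrightarrow> c \<in> \<real>)"

definition aff_C_bracket :: "real^4 \<Rightarrow> real^4 \<Rightarrow> real^4" where
  "aff_C_bracket x y =
     ((x $ 1 * y $ 3 - x $ 3 * y $ 1) - (x $ 2 * y $ 4 - x $ 4 * y $ 2)) *\<^sub>R axis 3 1 +
     ((x $ 1 * y $ 4 - x $ 4 * y $ 1) + (x $ 2 * y $ 3 - x $ 3 * y $ 2)) *\<^sub>R axis 4 1"

lemma aff_C_bracket_basis: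
  "aff_C_bracket (axis 1 1) (axis 2 1) = 0"
  "aff_C_bracket (axis 1 1) (axis 3 1) = axis 3 1"
  "aff_C_bracket (axis 1 1) (axis 4 1) = axis 4 1"
  "aff_C_bracket (axis 2 1) (axis 3 1) = axis 4 1"
  "aff_C_bracket (axis 2 1) (axis 4 1) = - axis 3 1"
  "aff_C_bracket (axis 3 1) (axis 4 1) = 0"
  by (simp_all add: aff_C_bracket_def axis_def)

lemma lie_algebra_aff_C: "lie_algebra aff_C_bracket"
  unfolding lie_algebra_def bilinear_def
  by (auto intro!: linearI simp: aff_C_bracket_def vec_eq_iff forall_4 axis_def algebra_simps)


section \<open>Symplectic forms\<close>

text \<open>A \<open>k\<close>-form is represented as a function of a sequence of vectors that depends only on
  the first \<open>k\<close> entries.\<close>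

definition wedge ::
  "nat \<Rightarrow> nat \<Rightarrow> ((nat \<Rightarrow> 'g) \<Rightarrow> real) \<Rightarrow> ((nat \<Rightarrow> 'g) \<Rightarrow> real) \<Rightarrow> (nat \<Rightarrow> 'g) \<Rightarrow> real" where
  "wedge k l \<alpha> \<beta> v =
     (\<Sum>\<sigma> | \<sigma> permutes {..<k + l}.
        of_int (sign \<sigma>) * \<alpha> (\<lambda>i. v (\<sigma> i)) * \<beta> (\<lambda>i. v (\<sigma> (k + i)))) / (fact k * fact l)"

primrec wedge_power :: "('g \<Rightarrow> 'g \<Rightarrow> real) \<Rightarrow> nat \<Rightarrow> (nat \<Rightarrow> 'g) \<Rightarrow> real" where
  "wedge_power \<omega> 0 = (\<lambda>v. 1)"
| "wedge_power \<omega> (Suc m) = wedge 2 (2 * m) (\<lambda>v. \<omega> (v 0) (v 1)) (wedge_power \<omega> m)"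

definition two_form :: "('g::real_vector \<Rightarrow> 'g \<Rightarrow> real) \<Rightarrow> bool" where
  "two_form \<omega> \<longleftrightarrow> bilinear \<omega> \<and> (\<forall>x. \<omega> x x = 0)"

text \<open>The Chevalley--Eilenberg differential of a 2-form (trivial coefficients).\<close>

definition ce_differential ::
  "('g \<Rightarrow> 'g \<Rightarrow> 'g) \<Rightarrow> ('g \<Rightarrow> 'g \<Rightarrow> real) \<Rightarrow> 'g \<Rightarrow> 'g \<Rightarrow> 'g \<Rightarrow> real" where
  "ce_differential br \<omega> x y z = - \<omega> (br x y) z + \<omega> (br x z) y - \<omega> (br y z) x"

definition closed_form :: "('g \<Rightarrow> 'g \<Rightarrow> 'g) \<Rightarrow> ('g \<Rightarrow> 'g \<Rightarrow> real) \<Rightarrow> bool" where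
  "closed_form br \<omega> \<longleftrightarrow> (\<forall>x y z. ce_differential br \<omega> x y z = 0)"

text \<open>The finite spanning set is required because \<^term>\<open>dim\<close> is \<open>0\<close> for
  infinite-dimensional spaces.\<close>

definition symplectic_form :: "('g::real_vector \<Rightarrow> 'g \<Rightarrow> 'g) \<Rightarrow> ('g \<Rightarrow> 'g \<Rightarrow> real) \<Rightarrow> bool" where
  "symplectic_form br \<omega> \<longleftrightarrow> two_form \<omega> \<and> closed_form br \<omega> \<and>
     (\<exists>B::'g set. finite B \<and> span B = UNIV) \<and>
     (\<exists>n. dim (UNIV :: 'g set) = 2 * n \<and> (\<exists>v. wedge_power \<omega> n v \<noteq> 0))"

definition symplectic_lie_algebra ::
  "('g::real_vector \<Rightarrow> 'g \<Rightarrow> 'g) \<Rightarrow> ('g \<Rightarrow> 'g \<Rightarrow> real) \<Rightarrow> bool" where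
  "symplectic_lie_algebra br \<omega> \<longleftrightarrow> lie_algebra br \<and> symplectic_form br \<omega>"


section \<open>The cotangent extension problem\<close>

text \<open>The dual space of \<open>'h\<close> is the type \<open>'h \<Rightarrow>\<^sub>L real\<close>: on a finite-dimensional space every linear
  functional is bounded.\<close>

definition canonical_form ::
  "('h::euclidean_space \<Rightarrow>\<^sub>L real) \<times> 'h \<Rightarrow> ('h \<Rightarrow>\<^sub>L real) \<times> 'h \<Rightarrow> real" where
  "canonical_form u u' =
     blinfun_apply (fst u) (snd u') - blinfun_apply (fst u') (snd u)"

definition short_exact_lie ::
  "('a::real_vector \<Rightarrow> 'a \<Rightarrow> 'a) \<Rightarrow> ('b::real_vector \<Rightarrow> 'b \<Rightarrow> 'b) \<Rightarrow> ('c::real_vector \<Rightarrow> 'c \<Rightarrow> 'c)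
    \<Rightarrow> ('a \<Rightarrow> 'b) \<Rightarrow> ('b \<Rightarrow> 'c) \<Rightarrow> bool" where
  "short_exact_lie brA brB brC i p \<longleftrightarrow>
     lie_algebra brA \<and> lie_algebra brB \<and> lie_algebra brC \<and>
     lie_hom brA brB i \<and> lie_hom brB brC p \<and>
     inj i \<and> range i = {b. p b = 0} \<and> surj p"

text \<open>\<open>brE\<close> is a Lie algebra structure on the direct sum of the dual space of \<open>'h\<close> (abelian, i.e.
  with zero bracket) and \<open>'h\<close> solving the problem for the Lie algebra \<open>('h, brh)\<close>.\<close>

definition cotangent_extension ::
  "('h::euclidean_space \<Rightarrow> 'h \<Rightarrow> 'h)
    \<Rightarrow> (('h \<Rightarrow>\<^sub>L real) \<times> 'h \<Rightarrow> ('h \<Rightarrow>\<^sub>L real) \<times> 'h \<Rightarrow> ('h \<Rightarrow>\<^sub>L real) \<times> 'h) \<Rightarrow> bool" where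
  "cotangent_extension brh brE \<longleftrightarrow>
     short_exact_lie (\<lambda>_ _. 0) brE brh (\<lambda>\<phi>. (\<phi>, 0)) snd \<and>
     closed_form brE canonical_form"

text \<open>The type argument is the vector space underlying the Lie algebra \<open>\<hh>\<close>, since HOL cannot
  quantify over types. This is harmless: a solution forces \<open>dim \<gg> = 2 dim \<hh>\<close>, and transporting
  the structure along a linear isomorphism shows that any \<open>'h\<close> of that dimension can serve.\<close>

definition cotangent_extension_solution ::
  "'h::euclidean_space itself \<Rightarrow> ('g::real_vector \<Rightarrow> 'g \<Rightarrow> 'g) \<Rightarrow> ('g \<Rightarrow> 'g \<Rightarrow> real) \<Rightarrow> bool" where
  "cotangent_extension_solution _ br \<omega> \<longleftrightarrow>
     (\<exists>(brh :: 'h \<Rightarrow> 'h \<Rightarrow> 'h) brE f.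
        cotangent_extension brh brE \<and> lie_iso br brE f \<and>
        (\<forall>x y. \<omega> x y = canonical_form (f x) (f y)))"

end

theory Submission
  imports Defs "HOL-Computational_Algebra.Fundamental_Theorem_Algebra"
begin

text \<open>
  It suffices to find a two-dimensional ideal \<open>\<aa>\<close> with \<open>\<omega> = 0\<close> on \<open>\<aa>\<close>. Such a Lagrangian ideal is abelian
  by closedness of \<open>\<omega>\<close>, the form identifies it with the dual of \<open>\<hh> = \<gg> / \<aa>\<close>, and a Lagrangian
  complement of \<open>\<aa>\<close> splits \<open>\<gg>\<close> as \<open>\<hh>\<^sup>* \<oplus> \<hh>\<close> so that \<open>\<omega>\<close> becomes the canonical form. In coordinates
  this is the choice of a Darboux basis \<open>a, b, c, d\<close> with \<open>a, b\<close> spanning \<open>\<aa>\<close>; see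
  \<open>lagrangian_ideal_imp_solution\<close>.

  For \<open>\<aa>\<ff>\<ff>(\<complex>)\<close> the ideal spanned by \<open>e\<^sub>3, e\<^sub>4\<close> works: \<open>e\<^sub>1\<close> acts on it as the identity, so closedness
  gives \<open>2 \<omega>(e\<^sub>3, e\<^sub>4) = 0\<close>.

  If \<open>\<gg>\<close> is completely solvable, Lie's theorem over the reals yields \<open>e \<noteq> 0\<close> with
  \<open>[y, e] = f(y) e\<close> for a linear functional \<open>f\<close> that vanishes on \<open>[\<gg>, \<gg>]\<close>
  (\<open>completely_solvable_weight_vector\<close>). Write \<open>f = \<omega>(l, _)\<close>. Closedness says
  \<open>\<omega>([x, y], e) = f(x) \<omega>(e, y) - f(y) \<omega>(e, x)\<close>, and two cases arise
  (\<open>weight_vector_lagrangian_ideal\<close>).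

  \<^item> If \<open>e\<close> and \<open>l\<close> are independent, they span a Lagrangian ideal: \<open>\<omega>(l, e) = f(e) = 0\<close>, and
    \<open>[z, l]\<close> is orthogonal to \<open>e\<close> by the displayed identity and to \<open>l\<close> because \<open>f\<close> vanishes
    on commutators.

  \<^item> If \<open>l\<close> is a multiple of \<open>e\<close>, then \<open>H = e\<^sup>\<bottom>\<close> is an ideal that centralizes \<open>e\<close>. What is needed is a
    line in the plane \<open>H / \<real>e\<close> that is stable under \<open>\<gg>\<close>. If this plane is a nonabelian Lie
    algebra, its derived algebra is such a line. Otherwise only one operator acts on it, and this
    operator has a real eigenvector since its eigenvalues are among those of some \<open>ad\<^sub>x\<close>.
\<close>

section \<open>Symplectic forms in dimension four\<close>

lemma sum_permutations_2:
  fixes F :: "(nat \<Rightarrow> nat) \<Rightarrow> real"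
  shows "(\<Sum>\<sigma> | \<sigma> permutes {..<2}. F \<sigma>) = F id + F (Transposition.transpose 0 1)"
proof -
  have S: "{..<2::nat} = {0, 1}" by auto
  have "finite {1::nat}" "0 \<notin> {1::nat}" "finite ({}::nat set)" "1 \<notin> ({}::nat set)" by auto
  then show ?thesis
    unfolding S by (simp add: sum_over_permutations_insert)
qed

lemma two_form_skew: "two_form \<omega> \<Longrightarrow> \<omega> x y = - \<omega> y x"
proof -
  assume a: "two_form \<omega>"
  then have b: "bilinear \<omega>" and z: "\<And>x. \<omega> x x = 0" by (auto simp: two_form_def)
  have "\<omega> (x + y) (x + y) = \<omega> x x + \<omega> x y + \<omega> y x + \<omega> y y"
    using b by (simp add: bilinear_ladd bilinear_radd)
  then show ?thesis by (simp add: z)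
qed

lemma wedge_power_1:
  assumes "two_form \<omega>"
  shows "wedge_power \<omega> (Suc 0) v = \<omega> (v 0) (v 1)"
  using two_form_skew[OF assms, of "v 1" "v 0"]
  by (simp add: wedge_def sum_permutations_2 sign_swap_id fact_numeral)

lemma sum_permutations_4:
  fixes F :: "(nat \<Rightarrow> nat) \<Rightarrow> real"
  shows "(\<Sum>\<sigma> | \<sigma> permutes {..<4}. F \<sigma>) = 
    (\<Sum>b\<in>{0,1,2,3}. \<Sum>c\<in>{1,2,3}. \<Sum>d\<in>{2,3}. F (Transposition.transpose 0 b \<circ> (Transposition.transpose 1 c \<circ> Transposition.transpose 2 d)))"
proof -
  have S: "{..<4::nat} = insert 0 (insert 1 (insert 2 (insert 3 {})))" by auto
  have 3: "{p. p permutes {3::nat}} = {id}" by auto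
  show ?thesis
    unfolding S 
    apply (subst sum_over_permutations_insert, simp, simp)
    apply (rule sum.cong[OF refl])
    apply (subst sum_over_permutations_insert, simp, simp)
    apply (rule sum.cong[OF refl])
    apply (subst sum_over_permutations_insert, simp, simp)
    apply (rule sum.cong[OF refl])
    apply (subst 3)
    apply simp
    done
qed

definition pfaffian :: "('g \<Rightarrow> 'g \<Rightarrow> real) \<Rightarrow> (nat \<Rightarrow> 'g) \<Rightarrow> real" where
  "pfaffian \<omega> v = \<omega> (v 0) (v 1) * \<omega> (v 2) (v 3) - \<omega> (v 0) (v 2) * \<omega> (v 1) (v 3) +
     \<omega> (v 0) (v 3) * \<omega> (v 1) (v 2)"

lemma wedge_power_2:
  assumes "two_form \<omega>"
  shows "wedge_power \<omega> 2 v = 2 * pfaffian \<omega> v"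
proof -
  note s = two_form_skew[OF assms]
  have e: "sign (Transposition.transpose 0 b \<circ> (Transposition.transpose 1 c \<circ> Transposition.transpose 2 d)) =
     sign (Transposition.transpose 0 b) * (sign (Transposition.transpose 1 c) * sign (Transposition.transpose 2 (d::nat)))" for b c d :: nat
    by (simp only: sign_compose permutation_swap_id permutation_compose)
  have "wedge_power \<omega> 2 v = (\<Sum>\<sigma> | \<sigma> permutes {..<4::nat}.
        of_int (sign \<sigma>) * \<omega> (v (\<sigma> 0)) (v (\<sigma> 1)) * \<omega> (v (\<sigma> 2)) (v (\<sigma> 3))) / 4"
  proof -
    have "wedge_power \<omega> (Suc 0) = (\<lambda>v. \<omega> (v 0) (v 1))"
      by (rule ext) (rule wedge_power_1[OF assms])
    then have "wedge_power \<omega> 2 = wedge 2 2 (\<lambda>v. \<omega> (v 0) (v 1)) (\<lambda>v. \<omega> (v 0) (v 1))"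
      by (simp only: numeral_2_eq_2 wedge_power.simps(2)[of _ "Suc 0"] mult_Suc_right mult_0_right
          add_0_right)
    then show ?thesis by (simp add: wedge_def fact_numeral)
  qed
  also have "\<dots> = 2 * pfaffian \<omega> v"
    unfolding sum_permutations_4 pfaffian_def e
    by (simp add: sign_swap_id s[of "v (Suc 0)" "v 0"] s[of "v 2" "v 0"] s[of "v 2" "v (Suc 0)"]
       s[of "v 3" "v 0"] s[of "v 3" "v (Suc 0)"] s[of "v 3" "v 2"])
  finally show ?thesis .
qed

text \<open>The type \<^typ>\<open>'g\<close> is only known to be a real vector space, so the usual fact about
  linearly independent families of full size is stated here in terms of the finite spanning set.\<close>

lemma spanning_of_independent:
  fixes v :: "nat \<Rightarrow> 'g::real_vector"
  assumes d: "dim (UNIV :: 'g set) = n" and B: "finite B" "span B = (UNIV :: 'g set)"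
    and ind: "\<And>c. (\<Sum>i<n. c i *\<^sub>R v i) = 0 \<Longrightarrow> \<forall>i<n. c i = 0"
  shows "\<exists>c. z = (\<Sum>i<n. c i *\<^sub>R v i)"
proof -
  have inj: "inj_on v {..<n}"
  proof (rule inj_onI, rule ccontr)
    fix i j assume ij: "i \<in> {..<n}" "j \<in> {..<n}" "v i = v j" "i \<noteq> j"
    define c :: "nat \<Rightarrow> real" where "c k = (if k = i then 1 else if k = j then - 1 else 0)" for k
    have "(\<Sum>k<n. c k *\<^sub>R v k)
        = (\<Sum>k<n. (if k = i then v k else 0) + (if k = j then - v k else 0))"
      using ij(4) by (intro sum.cong) (auto simp: c_def)
    also have "\<dots> = 0" using ij by (simp add: sum.distrib)
    finally have "c i = 0" using ind[of c] ij(1) by blast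
    then show False by (simp add: c_def)
  qed
  have indep: "independent (v ` {..<n})"
  proof
    assume "dependent (v ` {..<n})"
    then obtain u where u: "\<exists>x\<in>v ` {..<n}. u x \<noteq> 0" "(\<Sum>x\<in>v ` {..<n}. u x *\<^sub>R x) = 0"
      using dependent_finite[of "v ` {..<n}"] by blast
    then have "(\<Sum>i<n. u (v i) *\<^sub>R v i) = 0" by (simp add: sum.reindex[OF inj] o_def)
    then have "\<forall>i<n. u (v i) = 0" by (rule ind)
    then show False using u(1) by auto
  qed
  obtain C :: "'g set" where C: "independent C" "UNIV \<subseteq> span C" "card C = n"
    by (rule basis_exists[of "UNIV :: 'g set"]) (use d in auto)
  then have fC: "finite C" using independent_span_bound[OF B(1), of C] B(2) by auto
  have "z \<in> span (v ` {..<n})"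
  proof (rule ccontr)
    assume z: "z \<notin> span (v ` {..<n})"
    then have "independent (insert z (v ` {..<n}))" using indep by (rule independent_insertI)
    then have "card (insert z (v ` {..<n})) \<le> n"
      using independent_span_bound[OF fC] C by auto
    moreover have "z \<notin> v ` {..<n}" using z span_base[of z "v ` {..<n}"] by (rule contrapos_nn)
    ultimately have "Suc (card (v ` {..<n})) \<le> n" by (metis card_insert_disjoint finite_imageI finite_lessThan)
    then show False by (simp add: card_image[OF inj])
  qed
  then obtain u where "z = (\<Sum>x\<in>v ` {..<n}. u x *\<^sub>R x)"
    unfolding span_finite[OF finite_imageI[OF finite_lessThan]] by blast
  then have "z = (\<Sum>i<n. u (v i) *\<^sub>R v i)" by (simp only: sum.reindex[OF inj] o_def)
  then show ?thesis by (rule exI[of _ "\<lambda>i. u (v i)"])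
qed

lemmas bilinear_rules = bilinear_ladd bilinear_radd bilinear_lmul bilinear_rmul bilinear_lneg
  bilinear_rneg bilinear_lsub bilinear_rsub bilinear_lzero bilinear_rzero

text \<open>A nonzero Pfaffian makes the Gram matrix of \<open>v\<^sub>0, \<dots>, v\<^sub>3\<close> invertible, and its inverse applied to
  the \<open>v\<^sub>i\<close> gives vectors \<open>w\<^sub>i\<close> with \<open>\<omega>(w\<^sub>i, v\<^sub>j) = \<delta>\<^sub>i\<^sub>j\<close>. Hence the \<open>v\<^sub>i\<close> are independent and
  form a basis whose coordinate functionals are \<open>\<omega>(w\<^sub>i, _)\<close>. This one identity contains
  nondegeneracy of \<open>\<omega>\<close> as well as the representation of every functional by \<open>\<omega>\<close>.\<close>

lemma ex_dual_basis:
  fixes \<omega> :: "'g::real_vector \<Rightarrow> 'g \<Rightarrow> real"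
  assumes tf: "two_form \<omega>" and d: "dim (UNIV :: 'g set) = 4"
    and B: "finite B" "span B = (UNIV :: 'g set)" and pfaffian: "pfaffian \<omega> v \<noteq> 0"
  shows "\<exists>w. \<forall>z. z = (\<Sum>i<4. \<omega> (w i) z *\<^sub>R v i)"
proof -
  have b: "bilinear \<omega>" and z0: "\<omega> x x = 0" for x using tf by (auto simp: two_form_def)
  note s = two_form_skew[OF tf]
  note ss = s[of "v (Suc 0)" "v 0"] s[of "v 2" "v 0"] s[of "v 2" "v (Suc 0)"]
       s[of "v 3" "v 0"] s[of "v 3" "v (Suc 0)"] s[of "v 3" "v 2"]
  \<comment> \<open>The rows of the Pfaffian adjugate: the Gram matrix times this skew matrix is
    a scalar matrix, the scalar being the Pfaffian.\<close>
  define u where "u = (\<lambda>i::nat.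
     if i = 0 then - (\<omega> (v 2) (v 3) *\<^sub>R v 1 - \<omega> (v 1) (v 3) *\<^sub>R v 2 + \<omega> (v 1) (v 2) *\<^sub>R v 3)
     else if i = 1 then \<omega> (v 2) (v 3) *\<^sub>R v 0 - \<omega> (v 0) (v 3) *\<^sub>R v 2 + \<omega> (v 0) (v 2) *\<^sub>R v 3
     else if i = 2 then - (\<omega> (v 1) (v 3) *\<^sub>R v 0 - \<omega> (v 0) (v 3) *\<^sub>R v 1 + \<omega> (v 0) (v 1) *\<^sub>R v 3)
     else \<omega> (v 1) (v 2) *\<^sub>R v 0 - \<omega> (v 0) (v 2) *\<^sub>R v 1 + \<omega> (v 0) (v 1) *\<^sub>R v 2)"
  have four: "{..<4::nat} = {0, 1, 2, 3}" by auto
  have u: "\<forall>i\<in>{..<4}. \<forall>j\<in>{..<4}. \<omega> (u i) (v j) = (if i = j then pfaffian \<omega> v else 0)"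
    unfolding four
    by (simp add: u_def pfaffian_def bilinear_rules[OF b] z0 ss)
  define w where "w i = (1 / pfaffian \<omega> v) *\<^sub>R u i" for i
  have w: "\<omega> (w i) (v j) = (if i = j then 1 else 0)" if "i < 4" "j < 4" for i j
    using u that pfaffian by (simp add: w_def bilinear_rules[OF b])
  have lin: "linear (\<omega> x)" for x using b by (simp add: bilinear_def)
  have coef: "\<omega> (w i) (\<Sum>j<4. c j *\<^sub>R v j) = c i" if "i < 4" for c i
  proof -
    have "\<omega> (w i) (\<Sum>j<4. c j *\<^sub>R v j) = (\<Sum>j<4. c j * \<omega> (w i) (v j))"
      by (simp add: linear_sum[OF lin] bilinear_rules[OF b])
    also have "\<dots> = (\<Sum>j<4. if i = j then c j else 0)"
      by (intro sum.cong) (auto simp: w that)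
    finally show ?thesis using that by simp
  qed
  have "z = (\<Sum>i<4. \<omega> (w i) z *\<^sub>R v i)" for z
  proof -
    obtain c where z: "z = (\<Sum>i<4. c i *\<^sub>R v i)"
      using spanning_of_independent[OF d B, of v z] coef bilinear_rzero[OF b] by metis
    show ?thesis using coef[of _ c] by (simp add: z)
  qed
  then show ?thesis by blast
qed


section \<open>Operators with real eigenvalues\<close>

lemma ex_krylov_dependence:
  fixes v :: "nat \<Rightarrow> 'g::real_vector"
  assumes B: "finite B" "span B = (UNIV :: 'g set)"
  shows "\<exists>n. v n \<in> span (v ` {..<n})"
proof (rule ccontr)
  assume "\<nexists>n. v n \<in> span (v ` {..<n})"
  then have n: "v n \<notin> span (v ` {..<n})" for n by blast
  have "independent (v ` {..<n}) \<and> card (v ` {..<n}) = n" for n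
  proof (induction n)
    case (Suc n)
    have "v n \<notin> v ` {..<n}" using n[of n] span_base[of "v n" "v ` {..<n}"] by (rule contrapos_nn)
    then show ?case using Suc n[of n] by (simp add: lessThan_Suc independent_insertI)
  qed (simp add: independent_empty)
  then show False
    using independent_span_bound[OF B(1), of "v ` {..<Suc (card B)}"] B(2)
    by (metis subset_UNIV Suc_n_not_le_n)
qed

text \<open>The operator \<open>T - c\<close> on the complexification.\<close>

definition cshift :: "('g::real_vector \<Rightarrow> 'g) \<Rightarrow> complex \<Rightarrow> 'g \<times> 'g \<Rightarrow> 'g \<times> 'g" where
  "cshift T c w = complexified_map T w - complexified_scale c w"

lemma cshift_eq_0_iff: "cshift T c w = 0 \<longleftrightarrow> complexified_map T w = complexified_scale c w"
  by (simp add: cshift_def)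

lemma cshift_commute:
  assumes "linear T"
  shows "cshift T c (cshift T d w) = cshift T d (cshift T c w)"
  using assms
  by (simp add: cshift_def complexified_map_def complexified_scale_def linear_diff linear_add
      linear_cmul prod_eq_iff algebra_simps)

lemma fold_cshift_commute:
  assumes "linear T"
  shows "fold (cshift T) cs (cshift T c w) = cshift T c (fold (cshift T) cs w)"
proof (induction cs arbitrary: w)
  case (Cons a cs)
  then show ?case by (simp add: cshift_commute[OF assms, of a c w])
qed simp

text \<open>The vector \<open>p(T) w\<close> of the complexification.\<close>

definition poly_action :: "('g::real_vector \<Rightarrow> 'g) \<Rightarrow> complex poly \<Rightarrow> 'g \<times> 'g \<Rightarrow> 'g \<times> 'g" where
  "poly_action T p w = (\<Sum>i\<le>degree p. complexified_scale (coeff p i) ((complexified_map T ^^ i) w))"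

lemma complexified_scale_0 [simp]: "complexified_scale 0 w = 0"
  "complexified_scale c 0 = 0"
  by (simp_all add: complexified_scale_def zero_prod_def)

lemma poly_action_eq_sum:
  assumes "degree p \<le> n"
  shows "poly_action T p w = (\<Sum>i\<le>n. complexified_scale (coeff p i) ((complexified_map T ^^ i) w))"
  unfolding poly_action_def
  by (rule sum.mono_neutral_left) (use assms in \<open>auto simp: coeff_eq_0\<close>)

lemma poly_action_linear_factor:
  fixes T :: "'g::real_vector \<Rightarrow> 'g"
  assumes "linear T"
  shows "poly_action T ([:- c, 1:] * q) w = poly_action T q (cshift T c w)"
proof -
  define n where "n = degree q"
  define t where "t i = (complexified_map T ^^ i) w" for i
  have lin: "complexified_map T (complexified_scale a z) = complexified_scale a (complexified_map T z)"
    "complexified_map T (z - z') = complexified_map T z - complexified_map T z'"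
    for a z z'
    using assms by (simp_all add: complexified_map_def complexified_scale_def linear_diff linear_add
      linear_cmul prod_eq_iff)
  have scale: "complexified_scale (a - b) z = complexified_scale a z - complexified_scale b z"
    "complexified_scale (a * b) z = complexified_scale a (complexified_scale b z)"
    "complexified_scale a (z - z') = complexified_scale a z - complexified_scale a z'"
    for a b and z z' :: "'g \<times> 'g"
    by (simp_all add: complexified_scale_def prod_eq_iff algebra_simps)
  have ct: "(complexified_map T ^^ i) (cshift T c w) = t (Suc i) - complexified_scale c (t i)" for i
    by (induction i) (simp_all add: t_def cshift_def lin)
  have "degree ([:- c, 1:] * q) \<le> Suc n"
    using degree_mult_le[of "[:- c, 1:]" q] by (simp add: n_def)
  then have "poly_action T ([:- c, 1:] * q) w
      = (\<Sum>i\<le>Suc n. complexified_scale (coeff ([:- c, 1:] * q) i) (t i))"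
    by (simp add: poly_action_eq_sum t_def del: sum.atMost_Suc)
  also have "\<dots> = (\<Sum>i\<le>Suc n. complexified_scale (coeff (pCons 0 q) i) (t i)
       - complexified_scale (coeff q i) (complexified_scale c (t i)))"
  proof (intro sum.cong refl)
    fix i
    have "coeff ([:- c, 1:] * q) i = coeff (pCons 0 q) i - coeff q i * c" by simp
    then show "complexified_scale (coeff ([:- c, 1:] * q) i) (t i)
        = complexified_scale (coeff (pCons 0 q) i) (t i)
          - complexified_scale (coeff q i) (complexified_scale c (t i))"
      by (simp only: scale)
  qed
  also have "\<dots> = (\<Sum>i\<le>n. complexified_scale (coeff q i) (t (Suc i)))
      - (\<Sum>i\<le>n. complexified_scale (coeff q i) (complexified_scale c (t i)))"
    unfolding sum_subtractf
    by (subst sum.atMost_Suc_shift) (simp add: n_def coeff_eq_0)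
  also have "\<dots> = poly_action T q (cshift T c w)"
    by (simp add: poly_action_def ct n_def scale sum_subtractf)
  finally show ?thesis .
qed

text \<open>The fundamental theorem of algebra turns a polynomial annihilating \<open>w\<close> into a product of linear
  factors \<open>T - c\<close> annihilating \<open>w\<close>.\<close>

lemma ex_cshift_list:
  assumes "linear T"
  shows "p \<noteq> 0 \<Longrightarrow> poly_action T p w = 0 \<Longrightarrow> \<exists>cs. fold (cshift T) cs w = 0"
proof (induction "degree p" arbitrary: p w)
  case 0
  then obtain a where a: "p = [:a:]" "a \<noteq> 0" by (metis degree_eq_zeroE pCons_0_0)
  then have "complexified_scale (inverse a) (complexified_scale a w) = 0"
    using 0 by (simp add: poly_action_def)
  moreover have "complexified_scale (inverse a) (complexified_scale a w)
      = complexified_scale (inverse a * a) w"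
    by (simp add: complexified_scale_def prod_eq_iff algebra_simps)
  ultimately have "w = 0" using a by (simp add: complexified_scale_def)
  then show ?case by (intro exI[of _ "[]"]) simp
next
  case (Suc n)
  then have "\<not> constant (poly p)" by (simp add: constant_degree)
  then obtain c where "poly p c = 0" using fundamental_theorem_of_algebra by blast
  then obtain q where q: "p = [:- c, 1:] * q" by (metis dvd_def poly_eq_0_iff_dvd)
  then have "q \<noteq> 0" using Suc by auto
  then have "degree q = n" using Suc(2) unfolding q by (subst (asm) degree_mult_eq) auto
  then obtain cs where "fold (cshift T) cs (cshift T c w) = 0"
    using Suc(1)[of q "cshift T c w"] \<open>q \<noteq> 0\<close> Suc(4) q poly_action_linear_factor[OF assms] by auto
  then show ?case by (intro exI[of _ "c # cs"]) simp
qed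

lemma ex_annihilating_list:
  fixes T :: "'g::real_vector \<Rightarrow> 'g"
  assumes B: "finite B" "span B = (UNIV :: 'g set)" and T: "linear T"
  shows "\<exists>cs. fold (cshift T) cs (w, 0) = 0"
proof -
  obtain n where n: "(T ^^ n) w \<in> span ((\<lambda>i. (T ^^ i) w) ` {..<n})"
    using ex_krylov_dependence[OF B, of "\<lambda>i. (T ^^ i) w"] by blast
  have "\<exists>u. x = (\<Sum>i<n. u i *\<^sub>R (T ^^ i) w)" if "x \<in> span ((\<lambda>i. (T ^^ i) w) ` {..<n})" for x
    using that
  proof (induction rule: span_induct_alt)
    case base
    show ?case by (intro exI[of _ "\<lambda>_. 0"]) simp
  next
    case (step c x y)
    then obtain u j where "y = (\<Sum>i<n. u i *\<^sub>R (T ^^ i) w)" "j < n" "x = (T ^^ j) w" by blast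
    moreover have "(\<Sum>i<n. (u i + (if i = j then c else 0)) *\<^sub>R (T ^^ i) w)
       = (\<Sum>i<n. u i *\<^sub>R (T ^^ i) w) + (\<Sum>i<n. if i = j then c *\<^sub>R (T ^^ i) w else 0)"
      by (simp add: scaleR_add_left sum.distrib if_distrib[of "\<lambda>r. r *\<^sub>R _"] cong: if_cong)
    ultimately show ?case
      by (intro exI[of _ "\<lambda>i. u i + (if i = j then c else 0)"]) (simp add: add.commute)
  qed
  then obtain u where u: "(T ^^ n) w = (\<Sum>i<n. u i *\<^sub>R (T ^^ i) w)" using n by blast
  define p where "p = monom 1 n - (\<Sum>i<n. monom (complex_of_real (u i)) i)"
  have coeff_p: "coeff p i = (if i = n then 1 else if i < n then - complex_of_real (u i) else 0)" for i
    by (simp add: p_def coeff_sum)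
  then have "p \<noteq> 0" by (metis coeff_0 zero_neq_one)
  have deg: "degree p \<le> n" by (rule degree_le) (simp add: coeff_p)
  have pow: "(complexified_map T ^^ i) (w, 0) = ((T ^^ i) w, 0)" for i
    by (induction i) (simp_all add: complexified_map_def linear_0[OF T])
  have "poly_action T p (w, 0) = (\<Sum>i<n. - (u i *\<^sub>R (T ^^ i) w, 0)) + ((T ^^ n) w, 0)"
    by (simp add: poly_action_eq_sum[OF deg] lessThan_Suc_atMost[symmetric] pow coeff_p
        complexified_scale_def)
  also have "\<dots> = 0" by (simp add: u prod_eq_iff fst_sum snd_sum sum_negf)
  finally show ?thesis by (rule ex_cshift_list[OF T \<open>p \<noteq> 0\<close>])
qed

text \<open>In a shortest annihilating product, removing a factor \<open>T - c\<close> leaves a nonzero vector. Since the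
  factors commute, this vector is an eigenvector for \<open>c\<close>. So all factors of a shortest product are
  real as soon as all eigenvalues of \<open>T\<close> are.\<close>

lemma ex_real_annihilating_list:
  fixes T :: "'g::real_vector \<Rightarrow> 'g"
  assumes B: "finite B" "span B = (UNIV :: 'g set)" and T: "linear T"
    and real: "\<And>c. complex_eigenvalue T c \<Longrightarrow> c \<in> \<real>"
  shows "\<exists>cs. fold (\<lambda>c x. T x - c *\<^sub>R x) cs w = 0"
proof -
  define P where "P cs \<longleftrightarrow> fold (cshift T) cs (w, 0) = 0" for cs
  have "\<exists>cs. P cs" unfolding P_def by (rule ex_annihilating_list[OF B T])
  then obtain cs0 where "P cs0" ..
  from ex_has_least_nat[of P, OF this, of length]
  obtain cs where cs': "P cs \<and> (\<forall>ds. P ds \<longrightarrow> length cs \<le> length ds)" ..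
  then have cs: "P cs" "\<And>ds. P ds \<Longrightarrow> length cs \<le> length ds" by blast+
  have "c \<in> \<real>" if c: "c \<in> set cs" for c
  proof -
    obtain as bs where ab: "cs = as @ c # bs" using split_list[OF c] by blast
    have "cshift T c (fold (cshift T) (as @ bs) (w, 0)) = 0"
      using cs(1) by (simp add: ab P_def fold_cshift_commute[OF T])
    moreover have "fold (cshift T) (as @ bs) (w, 0) \<noteq> 0"
      using cs(2)[of "as @ bs"] by (auto simp: ab P_def)
    ultimately have "complex_eigenvalue T c"
      unfolding complex_eigenvalue_def cshift_eq_0_iff by blast
    then show ?thesis by (rule real)
  qed
  then obtain rs where rs: "cs = map complex_of_real rs"
    by (metis Reals_cases ex_map_conv)
  have "fold (cshift T) (map complex_of_real rs) (x, 0) = (fold (\<lambda>c x. T x - c *\<^sub>R x) rs x, 0)" for x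
    by (induction rs arbitrary: x)
      (simp_all add: cshift_def complexified_map_def complexified_scale_def linear_0[OF T])
  then show ?thesis using cs(1) by (auto simp: P_def rs zero_prod_def)
qed

text \<open>The factors of a real annihilating product are applied to \<open>w\<close> one after the other. The iterates
  remain in \<open>W\<close> and end at \<open>0\<close>; the last one outside \<open>U\<close> is the required vector. For \<open>U = {0}\<close> it is an
  eigenvector, and for a line \<open>U\<close> an eigenvector in the quotient of \<open>W\<close> by \<open>U\<close>.\<close>

lemma ex_relative_eigenvector:
  fixes T :: "'g::real_vector \<Rightarrow> 'g"
  assumes B: "finite B" "span B = (UNIV :: 'g set)" and T: "linear T"
    and real: "\<And>c. complex_eigenvalue T c \<Longrightarrow> c \<in> \<real>"
    and W: "subspace W" "\<And>x. x \<in> W \<Longrightarrow> T x \<in> W" and U: "0 \<in> U"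
    and w: "w \<in> W" "w \<notin> U"
  shows "\<exists>x c. x \<in> W \<and> x \<notin> U \<and> T x - c *\<^sub>R x \<in> U"
proof -
  have *: "\<exists>x c. x \<in> W \<and> x \<notin> U \<and> T x - c *\<^sub>R x \<in> U"
    if "fold (\<lambda>c x. T x - c *\<^sub>R x) cs w = 0" for cs
    using that w
  proof (induction cs arbitrary: w)
    case (Cons c cs)
    show ?case
    proof (cases "T w - c *\<^sub>R w \<in> U")
      case False
      moreover have "T w - c *\<^sub>R w \<in> W"
        using W Cons.prems by (simp add: subspace_diff subspace_scale)
      ultimately show ?thesis using Cons by simp
    qed (use Cons.prems in blast)
  qed (use U in auto)
  obtain cs where "fold (\<lambda>c x. T x - c *\<^sub>R x) cs w = 0"
    using ex_real_annihilating_list[OF B T real, of w] ..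
  then show ?thesis by (rule *)
qed


section \<open>Lie's theorem for completely solvable Lie algebras\<close>

lemma lie_skew:
  assumes "lie_algebra br"
  shows "br x y = - br y x"
proof -
  have b: "bilinear br" and z: "\<And>x. br x x = 0" using assms by (auto simp: lie_algebra_def)
  have "br (x + y) (x + y) = br x x + br x y + br y x + br y y"
    by (simp only: bilinear_rules[OF b] add_ac)
  then show ?thesis by (simp add: z eq_neg_iff_add_eq_0)
qed

lemma lie_leibniz:
  assumes "lie_algebra br"
  shows "br x (br y z) = br (br x y) z + br y (br x z)"
proof -
  have b: "bilinear br" and j: "br x (br y z) + br y (br z x) + br z (br x y) = 0"
    using assms by (auto simp: lie_algebra_def)
  then show ?thesis
    using lie_skew[OF assms, of z x] lie_skew[OF assms, of z "br x y"]
    by (simp add: bilinear_rules[OF b] algebra_simps)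
qed

text \<open>The key step of Lie's theorem, by a variant of the usual trace argument that needs no matrices.
  Let \<open>u\<^sub>n = (ad\<^sub>x)\<^sup>n v\<close> and let \<open>U\<^sub>n\<close> be the span of the first \<open>n\<close> of these vectors. Then
  \<open>[y, u\<^sub>n] = \<kappa>(y) u\<^sub>n + n \<kappa>([y, x]) u\<^sub>n\<^sub>-\<^sub>1\<close> modulo \<open>U\<^sub>n\<^sub>-\<^sub>1\<close>. For the first \<open>n\<close> with \<open>u\<^sub>n\<close> in \<open>U\<^sub>n\<close>, the operator
  \<open>ad\<^sub>y - \<kappa>(y)\<close> sends \<open>u\<^sub>n\<close> into \<open>U\<^sub>n\<^sub>-\<^sub>1\<close>, which leaves \<open>n \<kappa>([y, x]) u\<^sub>n\<^sub>-\<^sub>1\<close> in \<open>U\<^sub>n\<^sub>-\<^sub>1\<close>; this forces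
  \<open>\<kappa>([y, x]) = 0\<close>.\<close>

lemma weight_eq_0_on_commutators:
  fixes br :: "'g::real_vector \<Rightarrow> 'g \<Rightarrow> 'g"
  assumes B: "finite B" "span B = (UNIV :: 'g set)" and lie: "lie_algebra br"
    and s: "\<And>y. y \<in> s \<Longrightarrow> br y x \<in> s"
    and v: "v \<noteq> 0" "\<And>y. y \<in> s \<Longrightarrow> br y v = \<kappa> y *\<^sub>R v" and y: "y \<in> s"
  shows "\<kappa> (br y x) = 0"
proof -
  have b: "bilinear br" using lie by (simp add: lie_algebra_def)
  define u where "u n = (br x ^^ n) v" for n
  define U where "U n = span (u ` {..<n})" for n
  have U_mono: "m \<le> n \<Longrightarrow> U m \<subseteq> U n" for m n unfolding U_def by (intro span_mono) auto
  have u_U: "m < n \<Longrightarrow> u m \<in> U n" for m n unfolding U_def by (intro span_base) auto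
  have subU: "subspace (U n)" for n by (simp add: U_def)
  have xU: "br x z \<in> U (Suc n)" if "z \<in> U n" for z n
    using that unfolding U_def[of n]
  proof (induction rule: span_induct)
    case base
    show ?case
      using subU[of "Suc n"] by (auto simp: subspace_def bilinear_rules[OF b])
  next
    case (step z)
    then obtain m where m: "m < n" "z = u m" by auto
    then have "br x z = u (Suc m)" by (simp add: u_def)
    then show ?case using u_U[of "Suc m" "Suc n"] m by simp
  qed
  have key: "br y (u (Suc n)) - \<kappa> y *\<^sub>R u (Suc n) - (real (Suc n) * \<kappa> (br y x)) *\<^sub>R u n \<in> U n"
    if "y \<in> s" for y n
    using that
  proof (induction n arbitrary: y)
    case 0
    have "br y (u (Suc 0)) = br (br y x) v + br x (br y v)"
      using lie_leibniz[OF lie, of y x v] by (simp add: u_def)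
    then show ?case
      using 0 s v subspace_0[OF subU] by (simp add: bilinear_rules[OF b] u_def)
  next
    case (Suc n)
    define r where "r = br y (u (Suc n)) - \<kappa> y *\<^sub>R u (Suc n) - (real (Suc n) * \<kappa> (br y x)) *\<^sub>R u n"
    define r' where "r' = br (br y x) (u (Suc n)) - \<kappa> (br y x) *\<^sub>R u (Suc n)
       - (real (Suc n) * \<kappa> (br (br y x) x)) *\<^sub>R u n"
    have r: "r \<in> U n" "r' \<in> U n" unfolding r_def r'_def using Suc s by auto
    have xu: "br x (u n) = u (Suc n)" for n by (simp add: u_def)
    have "br y (u (Suc (Suc n))) = br (br y x) (u (Suc n)) + br x (br y (u (Suc n)))"
      using lie_leibniz[OF lie, of y x "u (Suc n)"] by (simp only: xu)
    also have "br x (br y (u (Suc n)))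
        = br x (r + \<kappa> y *\<^sub>R u (Suc n) + (real (Suc n) * \<kappa> (br y x)) *\<^sub>R u n)"
      by (simp add: r_def)
    finally have "br y (u (Suc (Suc n))) - \<kappa> y *\<^sub>R u (Suc (Suc n))
         - (real (Suc (Suc n)) * \<kappa> (br y x)) *\<^sub>R u (Suc n)
       = r' + (real (Suc n) * \<kappa> (br (br y x) x)) *\<^sub>R u n + br x r"
      by (simp add: r'_def bilinear_rules[OF b] xu algebra_simps)
        (simp only: scaleR_add_left[symmetric] mult_2[symmetric])
    also have "\<dots> \<in> U (Suc n)"
      using r U_mono[of n "Suc n"] xU u_U[of n "Suc n"] subU[of "Suc n"]
      by (intro subspace_add subspace_scale) auto
    finally show ?case .
  qed
  have tri: "br y z - \<kappa> y *\<^sub>R z \<in> U n" if "z \<in> U (Suc n)" for z n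
    using that unfolding U_def[of "Suc n"]
  proof (induction rule: span_induct)
    case base
    have *: "br y (a + c) - \<kappa> y *\<^sub>R (a + c) = (br y a - \<kappa> y *\<^sub>R a) + (br y c - \<kappa> y *\<^sub>R c)"
      "br y (k *\<^sub>R a) - \<kappa> y *\<^sub>R (k *\<^sub>R a) = k *\<^sub>R (br y a - \<kappa> y *\<^sub>R a)" for a c k
      by (simp_all add: bilinear_rules[OF b] algebra_simps)
    show ?case
      unfolding subspace_def mem_Collect_eq * using subU[of n]
      by (auto simp: bilinear_rules[OF b] subspace_0 intro: subspace_add subspace_scale)
  next
    case (step z)
    then obtain m where m: "m < Suc n" "z = u m" by auto
    show ?case
    proof (cases m)
      case 0
      then show ?thesis using m v y subspace_0[OF subU] by (simp add: u_def)
    next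
      case (Suc k)
      let ?r = "br y (u (Suc k)) - \<kappa> y *\<^sub>R u (Suc k) - (real (Suc k) * \<kappa> (br y x)) *\<^sub>R u k"
      have "?r + (real (Suc k) * \<kappa> (br y x)) *\<^sub>R u k \<in> U n"
        using key[OF y, of k] U_mono[of k n] u_U[of k n] subU[of n] m Suc
        by (intro subspace_add subspace_scale) auto
      then show ?thesis by (simp add: m Suc)
    qed
  qed
  define n where "n = (LEAST n. u n \<in> U n)"
  have ex: "\<exists>n. u n \<in> U n" using ex_krylov_dependence[OF B, of u] by (simp add: U_def)
  have n: "u n \<in> U n" unfolding n_def by (rule LeastI_ex[OF ex])
  have "n \<noteq> 0"
  proof
    assume "n = 0"
    then show False using n v by (simp add: U_def u_def)
  qed
  then obtain k where k: "n = Suc k" by (cases n) auto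
  have uk: "u k \<notin> U k" using not_less_Least[of k "\<lambda>n. u n \<in> U n"] k by (simp add: n_def)
  let ?c = "real (Suc k) * \<kappa> (br y x)"
  have "br y (u (Suc k)) - \<kappa> y *\<^sub>R u (Suc k) - (br y (u (Suc k)) - \<kappa> y *\<^sub>R u (Suc k) - ?c *\<^sub>R u k) \<in> U k"
    by (rule subspace_diff[OF subU tri key[OF y]]) (use n k in simp)
  then have c: "?c *\<^sub>R u k \<in> U k" by simp
  show ?thesis
  proof (rule ccontr)
    assume "\<kappa> (br y x) \<noteq> 0"
    then have "u k = (1 / ?c) *\<^sub>R (?c *\<^sub>R u k)" by simp
    then show False using subspace_scale[OF subU c, of "1 / ?c"] uk by simp
  qed
qed

definition has_weight_vector :: "('g::real_vector \<Rightarrow> 'g \<Rightarrow> 'g) \<Rightarrow> 'g set \<Rightarrow> bool" where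
  "has_weight_vector br s \<longleftrightarrow> (\<exists>v. v \<noteq> 0 \<and> (\<forall>y\<in>s. \<exists>c. br y v = c *\<^sub>R v))"

text \<open>Since the weight vanishes on \<open>[s, x]\<close>, its weight space is stable under \<open>ad\<^sub>x\<close>, and an eigenvector of
  \<open>ad\<^sub>x\<close> in this space is a weight vector for the enlarged space.\<close>

lemma has_weight_vector_insert:
  fixes br :: "'g::real_vector \<Rightarrow> 'g \<Rightarrow> 'g"
  assumes B: "finite B" "span B = (UNIV :: 'g set)" and lie: "lie_algebra br"
    and real: "\<And>x c. complex_eigenvalue (br x) c \<Longrightarrow> c \<in> \<real>"
    and s: "\<And>y. y \<in> s \<Longrightarrow> br y x \<in> s" and w: "has_weight_vector br s"
  shows "has_weight_vector br (span (insert x s))"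
proof -
  have b: "bilinear br" using lie by (simp add: lie_algebra_def)
  then have lin: "linear (br x)" for x by (simp add: bilinear_def)
  obtain v \<kappa> where v: "v \<noteq> 0" and \<kappa>: "\<And>y. y \<in> s \<Longrightarrow> br y v = \<kappa> y *\<^sub>R v"
    using w unfolding has_weight_vector_def by metis
  define W where "W = {w. \<forall>y\<in>s. br y w = \<kappa> y *\<^sub>R w}"
  have W: "subspace W" unfolding subspace_def W_def
    by (auto simp: bilinear_rules[OF b] algebra_simps)
  have "br x w \<in> W" if "w \<in> W" for w
    unfolding W_def
  proof (intro CollectI ballI)
    fix y assume y: "y \<in> s"
    have "br y (br x w) = br (br y x) w + br x (br y w)" by (rule lie_leibniz[OF lie])
    also have "br (br y x) w = \<kappa> (br y x) *\<^sub>R w" using that s[OF y] by (simp add: W_def)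
    also have "\<kappa> (br y x) = 0"
      using weight_eq_0_on_commutators[OF B lie s v \<kappa> y] by blast
    finally show "br y (br x w) = \<kappa> y *\<^sub>R br x w"
      using that y by (simp add: W_def bilinear_rules[OF b])
  qed
  moreover have "v \<in> W" "v \<notin> {0}" using v \<kappa> by (auto simp: W_def)
  ultimately obtain z c where z: "z \<in> W" "z \<notin> {0}" "br x z - c *\<^sub>R z \<in> {0}"
    using ex_relative_eigenvector[OF B lin[of x] real[of x] W, where U = "{0}" and w = v] by blast
  have "\<exists>c. br y z = c *\<^sub>R z" if "y \<in> span (insert x s)" for y
    using that
  proof (induction rule: span_induct_alt)
    case base
    show ?case by (intro exI[of _ 0]) (simp add: bilinear_rules[OF b])
  next
    case (step k y y')
    have "\<exists>d. br y z = d *\<^sub>R z" using step(1) z by (auto simp: W_def)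
    then show ?case using step(2)
      by (metis bilinear_ladd[OF b] bilinear_lmul[OF b] scaleR_add_left scaleR_scaleR)
  qed
  then show ?thesis using z unfolding has_weight_vector_def by blast
qed

text \<open>Lie's theorem for the adjoint representation. Every subspace between two consecutive terms of the
  derived series is an ideal in the larger one, so a weight vector of the smaller term can be
  extended by one vector at a time.\<close>

theorem completely_solvable_weight_vector:
  fixes br :: "'g::real_vector \<Rightarrow> 'g \<Rightarrow> 'g"
  assumes B: "finite B" "span B = (UNIV :: 'g set)" and lie: "lie_algebra br"
    and cs: "completely_solvable br" and "UNIV \<noteq> {0 :: 'g}"
  shows "has_weight_vector br UNIV"
proof -
  have real: "\<And>x c. complex_eigenvalue (br x) c \<Longrightarrow> c \<in> \<real>"
    using cs by (auto simp: completely_solvable_def)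
  obtain K where K: "derived_series br K = {0}"
    using cs by (auto simp: completely_solvable_def solvable_lie_def)
  have b: "bilinear br" using lie by (simp add: lie_algebra_def)
  let ?D = "derived_series br"
  have step: "has_weight_vector br (?D k)" if IH: "has_weight_vector br (?D (Suc k))" for k
  proof -
    have comm: "br y x \<in> ?D (Suc k)" if "y \<in> ?D k" "x \<in> ?D k" for x y
      using that by (auto intro: span_base)
    have subD: "subspace (?D j)" for j by (cases j) auto
    have mono: "?D (Suc j) \<subseteq> ?D j" for j
    proof (induction j)
      case (Suc j)
      show ?case by (subst (1 2) derived_series.simps(2), intro span_mono) (use Suc in blast)
    qed simp
    obtain F where F: "F \<subseteq> ?D k" "independent F" "?D k \<subseteq> span F" by (rule maximal_independent_subset)
    have "finite F" using independent_span_bound[OF B(1) F(2)] B(2) by auto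
    have "has_weight_vector br (span (G \<union> ?D (Suc k)))" if "G \<subseteq> F" for G
      using finite_subset[OF that \<open>finite F\<close>] that
    proof (induction G rule: finite_induct)
      case empty
      have "span (?D (Suc k)) = ?D (Suc k)" using subD by (simp only: span_eq_iff)
      then show ?case using IH by (simp only: Un_empty_left)
    next
      case (insert x G)
      let ?s = "span (G \<union> ?D (Suc k))"
      have "?s \<subseteq> ?D k"
        using insert F mono subD by (intro span_minimal) auto
      then have "br y x \<in> ?s" if "y \<in> ?s" for y
        using comm[of y x] insert.prems F that by (intro span_base) auto
      then have "has_weight_vector br (span (insert x ?s))"
        using insert by (intro has_weight_vector_insert[OF B lie real]) auto
      moreover have "span (insert x G \<union> ?D (Suc k)) \<subseteq> span (insert x ?s)"
        by (intro span_mono) (auto intro: span_base)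
      ultimately show ?case unfolding has_weight_vector_def by blast
    qed
    from this[of F] have "has_weight_vector br (span (F \<union> ?D (Suc k)))" by simp
    moreover have "?D k \<subseteq> span (F \<union> ?D (Suc k))"
      using F(3) span_mono[of F "F \<union> ?D (Suc k)"] by blast
    ultimately show ?thesis unfolding has_weight_vector_def by blast
  qed
  have "has_weight_vector br (?D (K - j))" if "j \<le> K" for j
    using that
  proof (induction j)
    case 0
    obtain v :: 'g where "v \<noteq> 0" using assms(5) by auto
    then show ?case unfolding has_weight_vector_def
      by (intro exI[of _ v]) (auto simp: K bilinear_rules[OF b] intro: exI[of _ 0])
  next
    case (Suc j)
    then show ?case using step[of "K - Suc j"] by (simp add: Suc_diff_Suc)
  qed
  from this[of K] show ?thesis by simp
qed


section \<open>Lagrangian ideals\<close>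

text \<open>If every \<open>c\<close> orthogonal to \<open>b\<close> were orthogonal to \<open>a\<close>, the functional \<open>\<omega>(a, _)\<close> would be a multiple of
  \<open>\<omega>(b, _)\<close>, hence \<open>a\<close> a multiple of \<open>b\<close>.\<close>

lemma ex_functional_separating:
  fixes \<omega> :: "'g::real_vector \<Rightarrow> 'g \<Rightarrow> real"
  assumes b: "bilinear \<omega>" and nondeg: "\<And>x. (\<And>y. \<omega> x y = 0) \<Longrightarrow> x = 0"
    and "a \<notin> span {b}"
  shows "\<exists>c. \<omega> a c = 1 \<and> \<omega> b c = 0"
proof (rule ccontr)
  assume no: "\<nexists>c. \<omega> a c = 1 \<and> \<omega> b c = 0"
  have 0: "\<omega> a c = 0" if "\<omega> b c = 0" for c
  proof (rule ccontr)
    assume "\<omega> a c \<noteq> 0"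
    then show False
      using no that by (auto simp: bilinear_rules[OF b] dest!: spec[of _ "(1 / \<omega> a c) *\<^sub>R c"])
  qed
  have "\<exists>k. a = k *\<^sub>R b"
  proof (cases "\<exists>u. \<omega> b u \<noteq> 0")
    case True
    then obtain u where u: "\<omega> b u \<noteq> 0" ..
    have "\<omega> (a - (\<omega> a u / \<omega> b u) *\<^sub>R b) y = 0" for y
      using 0[of "y - (\<omega> b y / \<omega> b u) *\<^sub>R u"] u by (simp add: bilinear_rules[OF b] field_simps)
    then have "a - (\<omega> a u / \<omega> b u) *\<^sub>R b = 0" by (rule nondeg)
    then show ?thesis by (intro exI[of _ "\<omega> a u / \<omega> b u"]) simp
  next
    case False
    then show ?thesis using 0 nondeg by (intro exI[of _ 0]) auto
  qed
  then show False using assms(3) by (auto simp: span_singleton)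
qed

text \<open>The nondegeneracy of \<open>\<omega>\<close> enters in the form delivered by \<open>ex_dual_basis\<close>.\<close>

locale symplectic_four =
  fixes br :: "'g::real_vector \<Rightarrow> 'g \<Rightarrow> 'g" and \<omega> :: "'g \<Rightarrow> 'g \<Rightarrow> real" and B :: "'g set"
  assumes dim_4: "dim (UNIV :: 'g set) = 4"
    and finite_B: "finite B" and span_B: "span B = UNIV"
    and lie: "lie_algebra br" and two_form: "two_form \<omega>" and closed: "closed_form br \<omega>"
    and dual_basis: "\<exists>(v :: nat \<Rightarrow> 'g) w. \<forall>z. z = (\<Sum>i<4. \<omega> (w i) z *\<^sub>R v i)"
begin

lemma bilinear_form: "bilinear \<omega>" and form_self [simp]: "\<omega> x x = 0"
  using two_form by (auto simp: two_form_def)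

lemma bilinear_bracket: "bilinear br" and bracket_self [simp]: "br x x = 0"
  using lie by (auto simp: lie_algebra_def)

lemmas form_rules = bilinear_rules[OF bilinear_form]
lemmas bracket_rules = bilinear_rules[OF bilinear_bracket]
lemmas form_skew = two_form_skew[OF two_form]
lemmas bracket_skew = lie_skew[OF lie]

lemma closed': "\<omega> (br x y) z = \<omega> (br x z) y - \<omega> (br y z) x"
proof -
  have "- \<omega> (br x y) z + \<omega> (br x z) y - \<omega> (br y z) x = 0"
    using closed by (simp only: closed_form_def ce_differential_def)
  then show ?thesis by linarith
qed

lemma nondegenerate:
  assumes "\<And>y. \<omega> x y = 0"
  shows "x = 0"
proof -
  obtain v w :: "nat \<Rightarrow> 'g" where vw: "\<And>z. z = (\<Sum>i<4. \<omega> (w i) z *\<^sub>R v i)" using dual_basis by blast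
  have "\<omega> (w i) x = 0" for i :: nat using assms[of "w i"] form_skew[of "w i" x] by simp
  then show ?thesis by (subst vw) simp
qed

lemma ex_dual_vector:
  fixes f :: "'g \<Rightarrow> real"
  assumes f: "linear f"
  shows "\<exists>l. \<forall>z. f z = \<omega> l z"
proof -
  obtain v w :: "nat \<Rightarrow> 'g" where vw: "\<And>z. z = (\<Sum>i<4. \<omega> (w i) z *\<^sub>R v i)" using dual_basis by blast
  have lin: "linear (\<lambda>x. \<omega> x z)" for z using bilinear_form by (simp add: bilinear_def)
  have "f z = \<omega> (\<Sum>i<4. f (v i) *\<^sub>R w i) z" for z
  proof -
    have "f z = f (\<Sum>i<4. \<omega> (w i) z *\<^sub>R v i)" by (rule arg_cong[OF vw])
    also have "\<dots> = (\<Sum>i<4. \<omega> (w i) z * f (v i))"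
      by (simp add: linear_sum[OF f] linear_cmul[OF f])
    also have "\<dots> = \<omega> (\<Sum>i<4. f (v i) *\<^sub>R w i) z"
      by (simp add: linear_sum[OF lin] form_rules mult.commute)
    finally show ?thesis .
  qed
  then show ?thesis by blast
qed

definition darboux :: "'g \<Rightarrow> 'g \<Rightarrow> 'g \<Rightarrow> 'g \<Rightarrow> bool" where
  "darboux a b c d \<longleftrightarrow> \<omega> a b = 0 \<and> \<omega> a c = 1 \<and> \<omega> a d = 0 \<and> \<omega> b c = 0 \<and> \<omega> b d = 1 \<and> \<omega> c d = 0"

lemma ex_darboux:
  assumes a: "a \<notin> span {b}" and b: "b \<notin> span {a}" and ab: "\<omega> a b = 0"
  shows "\<exists>c d. darboux a b c d"
proof -
  obtain c where c: "\<omega> a c = 1" "\<omega> b c = 0"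
    using ex_functional_separating[OF bilinear_form nondegenerate a] by blast
  obtain d where d: "\<omega> b d = 1" "\<omega> a d = 0"
    using ex_functional_separating[OF bilinear_form nondegenerate b] by blast
  show ?thesis
    using c d ab form_skew[of c a]
    by (intro exI[of _ c] exI[of _ "d + \<omega> c d *\<^sub>R a"]) (simp add: darboux_def form_rules form_skew[of b a])
qed

text \<open>The coefficients come from pairing with the basis; that \<open>a, b, c, d\<close> span is a dimension count.\<close>

lemma darboux_expansion:
  assumes "darboux a b c d"
  shows "z = \<omega> z c *\<^sub>R a + \<omega> z d *\<^sub>R b - \<omega> z a *\<^sub>R c - \<omega> z b *\<^sub>R d"
proof -
  note D = assms[unfolded darboux_def] form_skew[of b a] form_skew[of c a] form_skew[of d a]
    form_skew[of c b] form_skew[of d b] form_skew[of d c]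
  define v where "v i = (if i = 0 then a else if i = 1 then b else if i = 2 then c else d)" for i :: nat
  have four: "{..<4::nat} = {0, 1, 2, 3}" by auto
  have sum: "(\<Sum>i<4. k i *\<^sub>R v i) = k 0 *\<^sub>R a + k 1 *\<^sub>R b + k 2 *\<^sub>R c + k 3 *\<^sub>R d" for k :: "nat \<Rightarrow> real"
    unfolding four by (simp add: v_def)
  have "\<exists>k. z = (\<Sum>i<4. k i *\<^sub>R v i)"
  proof (rule spanning_of_independent[OF dim_4 finite_B span_B])
    fix k assume "(\<Sum>i<4. k i *\<^sub>R v i) = 0"
    then have "\<omega> (k 0 *\<^sub>R a + k 1 *\<^sub>R b + k 2 *\<^sub>R c + k 3 *\<^sub>R d) z = 0" for z
      by (simp only: sum form_rules)
    from this[of a] this[of b] this[of c] this[of d] have "\<forall>i\<in>{..<4}. k i = 0"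
      unfolding four by (simp add: form_rules D)
    then show "\<forall>i<4. k i = 0" by simp
  qed
  then obtain k :: "nat \<Rightarrow> real" where "z = k 0 *\<^sub>R a + k 1 *\<^sub>R b + k 2 *\<^sub>R c + k 3 *\<^sub>R d" by (auto simp: sum)
  then show ?thesis by (simp add: form_rules D)
qed

text \<open>A two-dimensional isotropic subspace is its own orthogonal complement, so stability of the span of
  \<open>a, b\<close> under the adjoint action is expressed by the vanishing of four values of \<open>\<omega>\<close>.\<close>

definition lagrangian_ideal :: "'g \<Rightarrow> 'g \<Rightarrow> bool" where
  "lagrangian_ideal a b \<longleftrightarrow> a \<noteq> 0 \<and> b \<notin> span {a} \<and> \<omega> a b = 0 \<and>
     (\<forall>z. \<omega> (br z a) a = 0 \<and> \<omega> (br z a) b = 0 \<and> \<omega> (br z b) a = 0 \<and> \<omega> (br z b) b = 0)"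

lemma not_span_swap:
  fixes a b :: 'g
  assumes "a \<noteq> 0" "b \<notin> span {a}"
  shows "a \<notin> span {b}"
proof
  assume "a \<in> span {b}"
  then obtain k where k: "a = k *\<^sub>R b" by (auto simp: span_singleton)
  then have "b = (1 / k) *\<^sub>R a" using assms(1) by auto
  then show False using assms(2) by (auto simp: span_singleton)
qed

text \<open>The case distinction is whether the weight \<open>f = \<omega>(l, _)\<close> is proportional to \<open>\<omega>(e, _)\<close>. If it is not, the
  common kernel of both functionals is a Lagrangian ideal. If it is, a second vector \<open>b\<close> is sought in
  the kernel \<open>H\<close> of \<open>\<omega>(e, _)\<close>; all conditions on it but \<open>\<omega>([z, b], b) = 0\<close> then hold automatically.\<close>

lemma weight_vector_lagrangian_ideal:
  assumes e: "e \<noteq> 0" and w: "\<And>y. \<exists>c. br y e = c *\<^sub>R e"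
    and real: "\<And>x c. complex_eigenvalue (br x) c \<Longrightarrow> c \<in> \<real>"
  shows "\<exists>a b. lagrangian_ideal a b"
proof -
  obtain f where f: "\<And>y. br y e = f y *\<^sub>R e" using w by metis
  have "linear f"
  proof (rule linearI)
    fix x y :: 'g and r :: real
    have "f (x + y) *\<^sub>R e = (f x + f y) *\<^sub>R e" "f (r *\<^sub>R x) *\<^sub>R e = (r *\<^sub>R f x) *\<^sub>R e"
      by (simp_all add: f[symmetric] bracket_rules scaleR_add_left) (simp add: f)
    then show "f (x + y) = f x + f y" "f (r *\<^sub>R x) = r *\<^sub>R f x" using e by (simp_all del: scaleR_scaleR)
  qed
  then obtain l where l: "\<And>z. f z = \<omega> l z" using ex_dual_vector by blast
  have fe: "f e = 0" using f[of e] e by simp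
  have f_comm: "f (br x y) = 0" for x y
  proof -
    have "br x (br y e) = br (br x y) e + br y (br x e)" by (rule lie_leibniz[OF lie])
    then show ?thesis using e by (simp add: f bracket_rules mult.commute)
  qed
  have form_comm: "\<omega> (br x y) e = f x * \<omega> e y - f y * \<omega> e x" for x y
    using closed'[of x y e] by (simp add: f form_rules)
  show ?thesis
  proof (cases "l \<in> span {e}")
    case False
    have "\<omega> (br z l) l = 0" for z using f_comm[of z l] l form_skew[of "br z l" l] by simp
    then have "lagrangian_ideal e l"
      using e False fe l form_skew[of e l]
      by (simp add: lagrangian_ideal_def f form_rules form_comm)
    then show ?thesis by blast
  next
    case True
    then obtain k where k: "l = k *\<^sub>R e" by (auto simp: span_singleton)
    have fk: "f z = k * \<omega> e z" for z by (simp add: l k form_rules)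
    define H where "H = {z. \<omega> e z = 0}"
    have H0: "f z = 0" "\<omega> z e = 0" if "z \<in> H" for z
      using that form_skew[of z e] by (simp_all add: fk H_def)
    have subH: "subspace H" by (auto simp: subspace_def H_def form_rules)
    have Hbr: "br z y \<in> H" for z y
      using form_comm[of z y] form_skew[of e "br z y"] by (simp add: H_def fk)
    obtain p where p: "p \<in> H" "p \<notin> span {e}"
    proof -
      obtain y where y: "\<omega> e y \<noteq> 0" using e nondegenerate[of e] by blast
      define x where "x = (1 / \<omega> e y) *\<^sub>R y"
      have x: "\<omega> e x = 1" using y by (simp add: x_def form_rules)
      have "\<exists>p. p \<in> H \<and> p \<notin> span {e}"
      proof (rule ccontr)
        assume "\<nexists>p. p \<in> H \<and> p \<notin> span {e}"
        then have "z - \<omega> e z *\<^sub>R x \<in> span {e}" for z by (auto simp: H_def form_rules x)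
        then have "z \<in> span {x, e}" for z
          by (subst span_breakdown_eq) blast
        then have "dim (UNIV :: 'g set) \<le> card {x, e}" by (intro dim_le_card) auto
        then show False using dim_4 by (simp add: card_insert_if split: if_splits)
      qed
      then show ?thesis using that by blast
    qed
    have pe: "e \<notin> span {p}" by (rule not_span_swap[OF e p(2)])
    have lag: "lagrangian_ideal e b"
      if "b \<in> H" "b \<notin> span {e}" "\<And>z. \<omega> (br z b) b = 0" for b
      using e that H0[of b] form_skew[of e b]
      by (simp add: lagrangian_ideal_def f form_rules form_comm H_def)
    obtain x q where D: "darboux e p x q"
      using ex_darboux[OF pe p(2)] H0(2)[OF p(1)] form_skew[of e p] by auto
    then have qH: "q \<in> H" by (simp add: darboux_def H_def)
    have eH: "br e y = 0" if "y \<in> H" for y using f[of y] H0(1)[OF that] bracket_skew[of e y] by simp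
    have exH: "y = \<omega> y x *\<^sub>R e + \<omega> y q *\<^sub>R p - \<omega> y p *\<^sub>R q" if "y \<in> H" for y
      using darboux_expansion[OF D, of y] H0(2)[OF that] by simp
    define u where "u = br p q"
    have uH: "u \<in> H" by (simp add: u_def Hbr)
    \<comment> \<open>\<open>H\<close> is spanned by \<open>e, p, q\<close>, and \<open>e\<close> commutes with \<open>H\<close>, so all commutators in \<open>H\<close> are
      multiples of \<open>[p, q]\<close>.\<close>
    have comm: "\<exists>r. br y z = r *\<^sub>R u" if "y \<in> H" "z \<in> H" for y z
    proof -
      have "br y z = br (\<omega> y x *\<^sub>R e + \<omega> y q *\<^sub>R p - \<omega> y p *\<^sub>R q) (\<omega> z x *\<^sub>R e + \<omega> z q *\<^sub>R p - \<omega> z p *\<^sub>R q)"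
        using exH that by metis
      also have "\<dots> = (\<omega> y p * \<omega> z q - \<omega> y q * \<omega> z p) *\<^sub>R u"
        using eH[OF p(1)] eH[OF qH] bracket_skew[of p e] bracket_skew[of q e] bracket_skew[of q p]
        by (simp add: bracket_rules u_def scaleR_diff_left mult.commute)
      finally show ?thesis by blast
    qed
    show ?thesis
    proof (cases "u \<in> span {e}")
      case False
      \<comment> \<open>\<open>u = [p, q]\<close> spans the derived algebra of the ideal \<open>H\<close>, which is again an ideal.\<close>
      have "\<omega> (br z u) u = 0" for z
      proof -
        have "br z u = br (br z p) q + br p (br z q)" unfolding u_def by (rule lie_leibniz[OF lie])
        moreover obtain r s where "br (br z p) q = r *\<^sub>R u" "br p (br z q) = s *\<^sub>R u"
          using comm[OF Hbr qH] comm[OF p(1) Hbr] by metis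
        ultimately show ?thesis by (simp add: form_rules)
      qed
      then show ?thesis using lag[OF uH False] by blast
    next
      case True
      \<comment> \<open>The derived algebra of \<open>H\<close> lies in the line of \<open>e\<close>, so on \<open>H / \<real>e\<close> only \<open>ad\<^sub>x\<close> acts
        nontrivially.\<close>
      have lin: "linear (br x)" using bilinear_bracket by (simp add: bilinear_def)
      obtain b c where b: "b \<in> H" "b \<notin> span {e}" "br x b - c *\<^sub>R b \<in> span {e}"
        using ex_relative_eigenvector[OF finite_B span_B lin real[of x] subH Hbr _ p] span_zero
        by blast
      obtain t where "br x b - c *\<^sub>R b = t *\<^sub>R e" using b(3) by (auto simp: span_singleton)
      then have xb: "\<omega> (br x b) b = 0" using b(1) by (simp add: diff_eq_eq form_rules H_def)
      have "\<omega> (br z b) b = 0" for z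
      proof -
        define y where "y = z + \<omega> z e *\<^sub>R x"
        have z: "z = y - \<omega> z e *\<^sub>R x" by (simp add: y_def)
        have "y \<in> H" using D form_skew[of e z] by (simp add: y_def H_def form_rules darboux_def)
        obtain t where "u = t *\<^sub>R e" using True by (auto simp: span_singleton)
        moreover obtain r where "br y b = r *\<^sub>R u" using comm[OF \<open>y \<in> H\<close> b(1)] ..
        ultimately have "\<omega> (br y b) b = 0" using b(1) by (simp add: form_rules H_def)
        then show ?thesis by (subst z) (simp add: bracket_rules form_rules xb)
      qed
      then show ?thesis using lag[OF b(1,2)] by blast
    qed
  qed
qed


section \<open>Lagrangian ideals and cotangent extensions\<close>

text \<open>A Darboux basis \<open>a, b, c, d\<close> identifies \<open>\<real>\<^sup>2\<close> with the complement spanned by \<open>c, d\<close> (the map \<open>g\<close>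
  below) and the ideal with the dual of \<open>\<real>\<^sup>2\<close> (by \<open>z \<mapsto> \<omega>(z, g(_))\<close>). The resulting
  map \<open>f\<close> carries \<open>\<omega>\<close> to the canonical form, and \<open>\<real>\<^sup>2\<close> and the direct sum receive their brackets from the
  quotient by the ideal and by transport along \<open>f\<close>.\<close>

theorem lagrangian_ideal_imp_solution:
  assumes lag: "lagrangian_ideal a b"
  shows "cotangent_extension_solution TYPE(real^2) br \<omega>"
proof -
  have ab: "a \<noteq> 0" "b \<notin> span {a}" "\<omega> a b = 0" "\<omega> b a = 0"
    and ideal: "\<omega> (br z a) a = 0" "\<omega> (br z a) b = 0" "\<omega> (br z b) a = 0" "\<omega> (br z b) b = 0" for z
    using lag form_skew[of b a] by (auto simp: lagrangian_ideal_def)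
  obtain c d where D: "darboux a b c d"
    using ex_darboux[OF not_span_swap[OF ab(1,2)] ab(2,3)] by blast
  note D' = D[unfolded darboux_def] form_skew[of b a] form_skew[of c a] form_skew[of d a]
    form_skew[of c b] form_skew[of d b] form_skew[of d c]
  have ideal': "\<omega> (br a z) a = 0" "\<omega> (br a z) b = 0" "\<omega> (br b z) a = 0" "\<omega> (br b z) b = 0" for z
    using ideal[of z] bracket_skew[of a z] bracket_skew[of b z] by (simp_all add: form_rules)
  have abelian: "br a b = 0"
  proof (rule nondegenerate)
    show "\<omega> (br a b) z = 0" for z using closed'[of a b z] ideal'[of z] by simp
  qed
  define g where "g x = (x $ 1) *\<^sub>R c + (x $ 2) *\<^sub>R d" for x :: "real^2"
  define P where "P z = ((\<chi> i. if i = 1 then - \<omega> z a else - \<omega> z b) :: real^2)" for z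
  define f where "f z = (Blinfun (\<lambda>x. \<omega> z (g x)), P z)" for z
  define h where "h u = blinfun_apply (fst u) (axis 1 1) *\<^sub>R a + blinfun_apply (fst u) (axis 2 1) *\<^sub>R b
    + g (snd u)" for u :: "((real^2) \<Rightarrow>\<^sub>L real) \<times> (real^2)"
  have g_lin: "linear g"
    by (rule linearI) (simp_all add: g_def algebra_simps)
  have P_lin: "linear P"
    by (rule linearI) (simp_all add: P_def vec_eq_iff form_rules)
  have P_eq: "P z = 0 \<longleftrightarrow> \<omega> z a = 0 \<and> \<omega> z b = 0" for z
    by (simp add: P_def vec_eq_iff forall_2)
  have apply_f: "blinfun_apply (fst (f z)) = (\<lambda>x. \<omega> z (g x))" for z
  proof -
    have "linear (\<lambda>x. \<omega> z (g x))"
      by (rule linearI) (simp_all add: linear_add[OF g_lin] linear_cmul[OF g_lin] form_rules)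
    then show ?thesis
      by (simp add: f_def bounded_linear_Blinfun_apply linear_conv_bounded_linear)
  qed
  have snd_f: "snd (f z) = P z" for z by (simp add: f_def)
  have f_lin: "linear f"
    by (rule linearI; rule prod_eqI)
      (auto intro!: blinfun_eqI simp: apply_f snd_f form_rules linear_add[OF P_lin]
        linear_cmul[OF P_lin] blinfun.add_left blinfun.scaleR_left)
  have h_lin: "linear h"
    by (rule linearI)
      (simp_all add: h_def linear_add[OF g_lin] linear_cmul[OF g_lin] blinfun.add_left
        blinfun.scaleR_left algebra_simps)
  have Pg: "P (g x) = x" for x
    by (simp add: P_def g_def vec_eq_iff forall_2 form_rules D')
  have g_axis: "g (axis 1 1) = c" "g (axis 2 1) = d" by (simp_all add: g_def axis_def)
  have hf: "h (f z) = z" for z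
  proof -
    have "h (f z) = \<omega> z c *\<^sub>R a + \<omega> z d *\<^sub>R b - \<omega> z a *\<^sub>R c - \<omega> z b *\<^sub>R d"
      by (simp add: h_def apply_f snd_f g_axis) (simp add: g_def P_def)
    also have "\<dots> = z" by (rule darboux_expansion[OF D, symmetric])
    finally show ?thesis .
  qed
  have Ph: "P (h u) = snd u" for u
    by (simp add: P_def h_def g_def vec_eq_iff forall_2 form_rules D')
  have fh: "f (h u) = u" for u
  proof (rule prod_eqI)
    show "fst (f (h u)) = fst u"
    proof (rule blinfun_eqI)
      fix x :: "real^2"
      have x: "x = x $ 1 *\<^sub>R axis 1 1 + x $ 2 *\<^sub>R axis 2 1"
        by (simp add: vec_eq_iff forall_2 axis_def)
      have "blinfun_apply (fst u) x
          = x $ 1 * blinfun_apply (fst u) (axis 1 1) + x $ 2 * blinfun_apply (fst u) (axis 2 1)"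
        by (subst x) (simp only: blinfun.add_right blinfun.scaleR_right real_scaleR_def)
      then show "blinfun_apply (fst (f (h u))) x = blinfun_apply (fst u) x"
        by (simp add: apply_f h_def g_def form_rules D')
    qed
  qed (simp add: snd_f Ph)
  have form: "canonical_form (f x) (f y) = \<omega> x y" for x y
  proof -
    have "\<omega> x y = \<omega> (\<omega> x c *\<^sub>R a + \<omega> x d *\<^sub>R b - \<omega> x a *\<^sub>R c - \<omega> x b *\<^sub>R d)
                 (\<omega> y c *\<^sub>R a + \<omega> y d *\<^sub>R b - \<omega> y a *\<^sub>R c - \<omega> y b *\<^sub>R d)"
      using darboux_expansion[OF D] by metis
    then show ?thesis
      by (simp add: canonical_form_def apply_f snd_f) (simp add: g_def P_def form_rules D' algebra_simps)
  qed
  define brh where "brh x y = P (br (g x) (g y))" for x y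
  define brE where "brE u v = f (br (h u) (h v))" for u v
  \<comment> \<open>The kernel of \<open>P\<close> is the ideal, so the bracket passes to the quotient.\<close>
  have P_br: "P (br z y) = brh (P z) (P y)" for z y
  proof -
    define z0 y0 where "z0 = \<omega> z c *\<^sub>R a + \<omega> z d *\<^sub>R b" and "y0 = \<omega> y c *\<^sub>R a + \<omega> y d *\<^sub>R b"
    have zy: "z = z0 + g (P z)" "y = y0 + g (P y)"
      by (rule trans[OF darboux_expansion[OF D]], simp add: z0_def y0_def g_def P_def)+
    have "P (br z0 w) = 0" "P (br w y0) = 0" for w
      by (simp_all add: P_eq z0_def y0_def bracket_rules form_rules ideal ideal')
    then have "P (br (z0 + g (P z)) (y0 + g (P y))) = P (br (g (P z)) (g (P y)))"
      by (simp add: bracket_rules linear_add[OF P_lin])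
    then show ?thesis by (simp only: zy[symmetric] brh_def)
  qed
  have jacobi: "br x (br y z) + br y (br z x) + br z (br x y) = 0" for x y z
    using lie by (simp add: lie_algebra_def)
  have lie_brh: "lie_algebra brh"
    unfolding lie_algebra_def
  proof (intro conjI allI)
    show "bilinear brh" unfolding bilinear_def
      by (auto intro!: linearI simp: brh_def linear_add[OF g_lin] linear_cmul[OF g_lin]
          bracket_rules linear_add[OF P_lin] linear_cmul[OF P_lin])
    show "brh x x = 0" for x by (simp add: brh_def linear_0[OF P_lin])
    have "brh x (brh y z) = P (br (g x) (br (g y) (g z)))" for x y z
      using P_br[of "g x" "br (g y) (g z)"] by (simp add: Pg brh_def)
    then show "brh x (brh y z) + brh y (brh z x) + brh z (brh x y) = 0" for x y z
      by (simp add: linear_add[OF P_lin, symmetric] jacobi linear_0[OF P_lin])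
  qed
  have lie_brE: "lie_algebra brE"
    unfolding lie_algebra_def
  proof (intro conjI allI)
    show "bilinear brE" unfolding bilinear_def
      by (intro conjI allI linearI) (simp_all only: brE_def linear_add[OF h_lin]
          linear_cmul[OF h_lin] bracket_rules linear_add[OF f_lin] linear_cmul[OF f_lin])
    show "brE x x = 0" for x by (simp add: brE_def linear_0[OF f_lin])
    show "brE x (brE y z) + brE y (brE z x) + brE z (brE x y) = 0" for x y z
      by (simp add: brE_def hf linear_add[OF f_lin, symmetric] jacobi linear_0[OF f_lin])
  qed
  have "short_exact_lie (\<lambda>_ _. 0) brE brh (\<lambda>\<phi>. (\<phi>, 0)) snd"
    unfolding short_exact_lie_def
  proof (intro conjI lie_brE lie_brh)
    show "lie_algebra (\<lambda>_ _. 0 :: (real^2) \<Rightarrow>\<^sub>L real)"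
      by (auto simp: lie_algebra_def bilinear_def intro!: linearI)
    have "br (h (\<phi>, 0)) (h (\<psi>, 0)) = 0" for \<phi> \<psi>
      using bracket_skew[of b a] by (simp add: h_def linear_0[OF g_lin] bracket_rules abelian)
    then show "lie_hom (\<lambda>_ _. 0) brE (\<lambda>\<phi>. (\<phi>, 0))"
      unfolding lie_hom_def
      by (auto intro!: linearI simp: brE_def linear_0[OF f_lin] zero_prod_def[symmetric])
    show "lie_hom brE brh snd"
      unfolding lie_hom_def by (auto intro!: linearI simp: brE_def snd_f P_br Ph)
    show "inj (\<lambda>\<phi> :: (real^2) \<Rightarrow>\<^sub>L real. (\<phi>, 0 :: real^2))" by (auto intro: injI)
    show "range (\<lambda>\<phi> :: (real^2) \<Rightarrow>\<^sub>L real. (\<phi>, 0 :: real^2)) = {u. snd u = 0}" by auto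
    show "surj (snd :: ((real^2) \<Rightarrow>\<^sub>L real) \<times> (real^2) \<Rightarrow> real^2)" by (rule surjI[of _ "Pair 0"]) simp
  qed
  moreover have "closed_form brE canonical_form"
    unfolding closed_form_def
  proof (intro allI)
    fix x y z
    have "canonical_form (brE x y) z = \<omega> (br (h x) (h y)) (h z)" for x y z
      using form[of "br (h x) (h y)" "h z"] by (simp add: brE_def fh)
    then show "ce_differential brE canonical_form x y z = 0"
      using closed by (simp add: closed_form_def ce_differential_def)
  qed
  moreover have "lie_iso br brE f"
    unfolding lie_iso_def lie_hom_def
    by (auto simp: f_lin brE_def hf intro!: o_bij[of h] fh hf)
  ultimately show ?thesis
    unfolding cotangent_extension_solution_def cotangent_extension_def
    using form by metis
qed

text \<open>The vectors \<open>a, b\<close> correspond to \<open>e\<^sub>3, e\<^sub>4\<close> and \<open>x\<close> to \<open>e\<^sub>1\<close>.\<close>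

lemma aff_C_lagrangian_ideal:
  assumes "lie_isomorphic br aff_C_bracket"
  shows "\<exists>a b. lagrangian_ideal a b"
proof -
  obtain F where F: "linear F" "bij F" and hom: "\<And>x y. F (br x y) = aff_C_bracket (F x) (F y)"
    using assms by (auto simp: lie_isomorphic_def lie_iso_def lie_hom_def)
  obtain x a b where xab: "F x = axis 1 1" "F a = axis 3 1" "F b = axis 4 1"
    using bij_is_surj[OF F(2)] by (metis surjD)
  have inj: "F y = F z \<Longrightarrow> y = z" for y z using bij_is_inj[OF F(2)] by (simp add: inj_eq)
  have za: "br z a = F z $ 1 *\<^sub>R a + F z $ 2 *\<^sub>R b" and zb: "br z b = F z $ 1 *\<^sub>R b - F z $ 2 *\<^sub>R a" for z
    by (rule inj, simp add: hom xab linear_add[OF F(1)] linear_diff[OF F(1)] linear_cmul[OF F(1)]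
        aff_C_bracket_def axis_def vec_eq_iff forall_4)+
  have x: "br x a = a" "br x b = b" using za[of x] zb[of x] by (simp_all add: xab axis_def)
  have "br a b = 0" using zb[of a] by (simp add: xab axis_def)
  \<comment> \<open>Closedness on \<open>x, a, b\<close> reads \<open>\<omega>(a, b) = \<omega>(b, a)\<close>.\<close>
  then have ab: "\<omega> a b = 0"
    using closed'[of x a b] form_skew[of b a] by (simp add: x form_rules)
  have "a \<noteq> 0" using xab(2) linear_0[OF F(1)] by (auto simp: axis_eq_0_iff)
  moreover have "b \<notin> span {a}"
  proof
    assume "b \<in> span {a}"
    then obtain k where "b = k *\<^sub>R a" by (auto simp: span_singleton)
    then have "(axis 4 1 :: real^4) = k *\<^sub>R axis 3 1" using xab linear_cmul[OF F(1)] by metis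
    then have "(axis 4 1 :: real^4) $ 4 = (k *\<^sub>R axis 3 1 :: real^4) $ 4" by simp
    then show False by (simp add: axis_def)
  qed
  ultimately have "lagrangian_ideal a b"
    using ab form_skew[of b a] by (simp add: lagrangian_ideal_def za zb form_rules)
  then show ?thesis by blast
qed

end

theorem mainTheorem4:
  fixes br :: "'g::real_vector \<Rightarrow> 'g \<Rightarrow> 'g"
    and \<omega> :: "'g \<Rightarrow> 'g \<Rightarrow> real"
  assumes "dim (UNIV :: 'g set) = 4"
    and "symplectic_lie_algebra br \<omega>"
    and "completely_solvable br \<or> lie_isomorphic br aff_C_bracket"
  shows "cotangent_extension_solution TYPE(real^2) br \<omega>"
proof -
  have lie: "lie_algebra br" and tf: "two_form \<omega>" and closed: "closed_form br \<omega>"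
    using assms(2) by (simp_all add: symplectic_lie_algebra_def symplectic_form_def)
  obtain B :: "'g set" where B: "finite B" "span B = UNIV"
    using assms(2) by (auto simp: symplectic_lie_algebra_def symplectic_form_def)
  obtain v where "wedge_power \<omega> 2 v \<noteq> 0"
    using assms(1,2) by (auto simp: symplectic_lie_algebra_def symplectic_form_def)
  then have "pfaffian \<omega> v \<noteq> 0" by (simp add: wedge_power_2[OF tf])
  then interpret symplectic_four br \<omega> B
    using ex_dual_basis[OF tf assms(1) B, of v] assms(1) B lie tf closed by unfold_locales blast+
  have "\<exists>a b. lagrangian_ideal a b"
    using assms(3)
  proof
    assume cs: "completely_solvable br"
    have "(UNIV :: 'g set) \<noteq> {0}"
    proof
      assume "(UNIV :: 'g set) = {0}"
      then have "dim (UNIV :: 'g set) \<le> card ({} :: 'g set)" by (intro dim_le_card) auto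
      then show False using assms(1) by simp
    qed
    then obtain e where "e \<noteq> 0" "\<And>y. \<exists>c. br y e = c *\<^sub>R e"
      using completely_solvable_weight_vector[OF B lie cs] by (auto simp: has_weight_vector_def)
    then show ?thesis
      using cs by (intro weight_vector_lagrangian_ideal) (auto simp: completely_solvable_def)
  qed (rule aff_C_lagrangian_ideal)
  then show ?thesis using lagrangian_ideal_imp_solution by blast
qed

end
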